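(* Let $M\in\mathbb{R}^{2n\times 2n}$ be symmetric positive-definite and let $1\le k\le n$. Every local minimizer of the optimization problem $\min_{X\in\mathbb{R}^{2n\times 2k}} \mathrm{tr}(X^TMX)$ subject to $X^TJ_{2n}X=J_{2k}$ is a global minimizer of it.
   Context: Let $J_{2n}=\begin{bmatrix}0&I_n\\-I_n&0\end{bmatrix}$, where $I_n$ is the $n\times n$ identity matrix. Local minimizers are understood relative to the feasible set $\{X\in\mathbb{R}^{2n\times 2k}: X^TJ_{2n}X=J_{2k}\}$ with the topology induced from $\mathbb{R}^{2n\times 2k}$. *)

theory Defs
  imports "HOL-Analysis.Analysis"
begin

(* A matrix of size 2n x 2k has type real^('k + 'k)^('n + 'n) with n = CARD('n), k = CARD('k);
   the summands Inl and Inr index the first and the second block. *)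

definition J_mat :: "real^('n::finite + 'n)^('n + 'n)" where
  "J_mat = (\<chi> i j. case (i, j) of
      (Inl a, Inr b) \<Rightarrow> if a = b then 1 else 0
    | (Inr a, Inl b) \<Rightarrow> if a = b then - 1 else 0
    | _ \<Rightarrow> 0)"

definition symplectic_feasible :: "(real^('k::finite + 'k)^('n::finite + 'n)) set" where
  "symplectic_feasible = {X. transpose X ** J_mat ** X = J_mat}"

definition sym_pos_def :: "real^'m^'m \<Rightarrow> bool" where
  "sym_pos_def M \<longleftrightarrow> transpose M = M \<and> (\<forall>x. x \<noteq> 0 \<longrightarrow> 0 < x \<bullet> (M *v x))"

definition global_minimizer :: "('a \<Rightarrow> real) \<Rightarrow> 'a set \<Rightarrow> 'a \<Rightarrow> bool" where
  "global_minimizer f S x \<longleftrightarrow> x \<in> S \<and> (\<forall>y\<in>S. f x \<le> f y)"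

definition local_minimizer :: "('a::topological_space \<Rightarrow> real) \<Rightarrow> 'a set \<Rightarrow> 'a \<Rightarrow> bool" where
  "local_minimizer f S x \<longleftrightarrow>
     (\<exists>U. openin (top_of_set S) U \<and> x \<in> U \<and> (\<forall>y\<in>U. f x \<le> f y))"

end

(* A symplectic transvection I + t v v^T J moves a feasible point within the feasible set, so a local
   minimizer X is stationary in the sense J M X = X J A, where A = X^T M X commutes with J.
   Rotating an eigenplane of A for its largest eigenvalue d into the J-complement W of the range of X
   gives the second-order condition z^T M z + z'^T M z' >= 2 d z^T J z' for z, z' in W.

   A global minimizer Y exists by compactness and is stationary as well, with B = Y^T M Y. Write
   Y = X P + Z with Z in W. The stationarity equations force A P = P B and J P = P J, hence
   Z^T J Z = R J and Z^T M Z = R B with R = 1 - P^T P positive semidefinite. By the second-order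
   condition tr (R B) >= d tr R, so tr B - tr A >= tr ((d - A) (1 - P P^T)) >= 0. *)
theory Submission imports Defs
begin

section \<open>Matrix algebra\<close>

lemma mm_minus_left: "(- A) ** B = - (A ** B)" for A :: "real^'b^'a" and B :: "real^'c^'b"
  by (simp add: matrix_matrix_mult_def vec_eq_iff sum_negf)

lemma mm_minus_right: "A ** (- B) = - (A ** B)" for A :: "real^'b^'a" and B :: "real^'c^'b"
  by (simp add: matrix_matrix_mult_def vec_eq_iff sum_negf)

lemma mm_add_left: "(A + C) ** B = A ** B + C ** B" for A :: "real^'b^'a" and B :: "real^'c^'b"
  by (simp add: matrix_matrix_mult_def vec_eq_iff sum.distrib distrib_right)

lemma mm_diff_left: "(A - C) ** B = A ** B - C ** B" for A :: "real^'b^'a" and B :: "real^'c^'b"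
  by (simp add: matrix_matrix_mult_def vec_eq_iff sum_subtractf left_diff_distrib)

lemma mm_diff_right: "A ** (B - C) = A ** B - A ** C" for A :: "real^'b^'a" and B :: "real^'c^'b"
  by (simp add: matrix_matrix_mult_def vec_eq_iff sum_subtractf right_diff_distrib)

lemma mm_scaleR_left: "(r *\<^sub>R A) ** B = r *\<^sub>R (A ** B)" for A :: "real^'b^'a" and B :: "real^'c^'b"
  by (simp add: matrix_matrix_mult_def vec_eq_iff sum_distrib_left mult.assoc)

lemma mm_scaleR_right: "A ** (r *\<^sub>R B) = r *\<^sub>R (A ** B)" for A :: "real^'b^'a" and B :: "real^'c^'b"
  by (simp add: matrix_scalar_ac mm_scaleR_left)

lemma mv_minus_left: "(- A) *v x = - (A *v x)" for A :: "real^'b^'a"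
  by (simp add: matrix_vector_mult_def vec_eq_iff sum_negf)

lemma mv_minus_right: "A *v (- x) = - (A *v x)" for A :: "real^'b^'a"
  by (simp add: matrix_vector_mult_def vec_eq_iff sum_negf)

lemma mv_scaleR_left: "(r *\<^sub>R A) *v x = r *\<^sub>R (A *v x)" for A :: "real^'b^'a"
  by (simp add: matrix_vector_mult_def vec_eq_iff sum_distrib_left mult.assoc)

lemma transpose_add: "transpose (A + B) = transpose A + transpose B" for A B :: "real^'b^'a"
  by (simp add: transpose_def vec_eq_iff)

lemma transpose_diff: "transpose (A - B) = transpose A - transpose B" for A B :: "real^'b^'a"
  by (simp add: transpose_def vec_eq_iff)

lemma transpose_minus: "transpose (- A) = - transpose A" for A :: "real^'b^'a"
  by (simp add: transpose_def vec_eq_iff)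

lemma transpose_zero: "transpose 0 = (0 :: real^'b^'a)"
  by (simp add: transpose_def vec_eq_iff)

lemma trace_scaleR: "trace (r *\<^sub>R A) = r * trace A" for A :: "real^'a^'a"
  by (simp add: trace_def sum_distrib_left)

lemma trace_transpose: "trace (transpose A) = trace A" for A :: "real^'a^'a"
  by (simp add: trace_def transpose_def)

lemma inner_transpose_mv: "x \<bullet> (transpose A *v y) = (A *v x) \<bullet> y" for A :: "real^'b^'a"
  by (metis dot_lmul_matrix inner_commute transpose_matrix_vector)

lemma trace_eq_sum_inner: "trace A = (\<Sum>i\<in>UNIV. axis i 1 \<bullet> (A *v axis i 1))" for A :: "real^'a^'a"
  by (simp add: trace_def inner_axis' matrix_vector_mul_component inner_axis)

lemma mv_axis: "(A *v axis j 1) $ i = A $ i $ j" for A :: "real^'b^'a"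
  by (simp add: matrix_vector_mul_component inner_axis)

text \<open>Keeps \<open>transpose A *v x\<close> in this shape, so that
  \<open>inner_transpose_mv\<close> can move transposes across inner products.\<close>

declare transpose_matrix_vector [simp del]

section \<open>Rank-one matrices and their products\<close>

definition outer :: "real^'a \<Rightarrow> real^'b \<Rightarrow> real^'b^'a" where
  "outer u v = (\<chi> i j. u $ i * v $ j)"

lemma mm_outer: "A ** outer u v = outer (A *v u) v"
  by (simp add: outer_def matrix_matrix_mult_def matrix_vector_mult_def vec_eq_iff
      sum_distrib_right mult.assoc)

lemma outer_mm: "outer u v ** A = outer u (transpose A *v v)"
  by (simp add: outer_def matrix_matrix_mult_def matrix_vector_mult_def transpose_def vec_eq_iff
      sum_distrib_left mult_ac del: transpose_matrix_vector)

lemma outer_mm_outer: "outer u v ** outer w x = (v \<bullet> w) *\<^sub>R outer u x"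
  by (simp add: outer_def matrix_matrix_mult_def inner_vec_def vec_eq_iff
      sum_distrib_left sum_distrib_right mult_ac)

lemma outer_mv: "outer u v *v w = (v \<bullet> w) *\<^sub>R u"
  by (simp add: outer_def matrix_vector_mult_def inner_vec_def vec_eq_iff
      sum_distrib_left sum_distrib_right mult_ac)

lemma transpose_outer: "transpose (outer u v) = outer v u"
  by (simp add: outer_def transpose_def vec_eq_iff mult.commute)

lemma trace_outer: "trace (outer u v) = u \<bullet> v"
  by (simp add: outer_def trace_def inner_vec_def)

lemma outer_minus_left: "outer (- u) v = - outer u v"
  by (simp add: outer_def vec_eq_iff)

lemma outer_minus_right: "outer u (- v) = - outer u v"
  by (simp add: outer_def vec_eq_iff)

lemma outer_zero: "outer 0 v = 0" "outer u 0 = 0"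
  by (simp_all add: outer_def vec_eq_iff)

lemma outer_scaleR: "outer (r *\<^sub>R u) v = r *\<^sub>R outer u v" "outer u (r *\<^sub>R v) = r *\<^sub>R outer u v"
  by (simp_all add: outer_def vec_eq_iff)

text \<open>Normal form of matrix expressions: products nested to the right, sums expanded,
  transposes pushed down to single factors.\<close>

lemmas mm_simps = matrix_mul_assoc[symmetric] matrix_transpose_mul
  matrix_add_ldistrib mm_add_left mm_diff_left mm_diff_right mm_minus_left mm_minus_right
  mm_scaleR_left mm_scaleR_right transpose_add transpose_diff transpose_minus transpose_scalar

section \<open>The symplectic matrix J\<close>

lemma transpose_J: "transpose J_mat = - J_mat"
  by (auto simp: transpose_def J_mat_def vec_eq_iff split: sum.splits)

lemma J_J: "J_mat ** J_mat = (- mat 1 :: real^('n::finite + 'n)^('n + 'n))"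
proof -
  have row: "J_mat $ Inl a $ l = (if l = Inr a then 1 else 0)"
    "J_mat $ Inr a $ l = (if l = Inl a then - 1 else 0)" for a :: 'n and l
    by (cases l; auto simp: J_mat_def)+
  have "(\<Sum>l\<in>UNIV. J_mat $ i $ l * J_mat $ l $ j) = (- mat 1 :: real^('n + 'n)^('n + 'n)) $ i $ j"
    for i j :: "'n + 'n"
    by (cases i) (auto simp: row mat_def if_distrib[where f = "\<lambda>c. c * _"] cong: if_cong)
  then show ?thesis
    by (simp add: matrix_matrix_mult_def vec_eq_iff)
qed

text \<open>In right-nested products two adjacent J's appear in this form, which \<open>J_J\<close>
  alone does not match.\<close>

lemma J_J_mm: "J_mat ** (J_mat ** A) = - A"
  by (simp add: matrix_mul_assoc J_J mm_minus_left)

lemma J_J_mv: "J_mat *v (J_mat *v x) = - x"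
  by (simp add: matrix_vector_mul_assoc J_J mv_minus_left)

lemma inner_J_skew: "x \<bullet> (J_mat *v y) = - ((J_mat *v x) \<bullet> y)"
  using inner_transpose_mv[of x J_mat y] by (simp add: transpose_J mv_minus_left del: transpose_matrix_vector)

lemma inner_J_self: "x \<bullet> (J_mat *v x) = 0"
  using inner_J_skew[of x x] by (simp add: inner_commute)

lemmas J_simps = transpose_J J_J J_J_mm

text \<open>0 is a local minimum of a t + b t^2, so the derivative a there vanishes. First-order
  conditions are extracted this way.\<close>

lemma linear_coeff_zero:
  fixes a b d :: real
  assumes "0 < d" and ge: "\<And>t. \<bar>t\<bar> < d \<Longrightarrow> 0 \<le> a * t + b * t\<^sup>2"
  shows "a = 0"
proof -
  have "((\<lambda>t. a * t + b * t\<^sup>2) has_real_derivative a) (at 0)"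
    by (auto intro!: derivative_eq_intros)
  then show ?thesis
    by (rule DERIV_local_min[OF _ \<open>0 < d\<close>]) (use ge in auto)
qed

section \<open>Positive semidefinite matrices\<close>

text \<open>Perturbing v to v + t C v changes the quadratic form by 2 t |C v|^2 + O(t^2). This must
  be nonnegative for both signs of t, so C v = 0.\<close>

lemma psd_kernel:
  fixes C :: "real^'a^'a"
  assumes sym: "transpose C = C" and psd: "\<And>x. 0 \<le> x \<bullet> (C *v x)" and "v \<bullet> (C *v v) = 0"
  shows "C *v v = 0"
proof -
  define w where "w = C *v v"
  have vw: "v \<bullet> (C *v w) = w \<bullet> w"
    using inner_transpose_mv[of v C w] sym by (simp add: w_def)
  have "2 * (w \<bullet> w) = 0"
  proof (rule linear_coeff_zero[of 1])
    fix t :: real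
    show "0 \<le> 2 * (w \<bullet> w) * t + (w \<bullet> (C *v w)) * t\<^sup>2"
      using psd[of "v + t *\<^sub>R w"] vw assms(3)
      by (simp add: matrix_vector_right_distrib matrix_vector_mult_scaleR inner_add_left inner_add_right
          w_def[symmetric] power2_eq_square algebra_simps)
  qed simp
  then show ?thesis
    by (simp add: w_def)
qed

text \<open>A minimizer u of v^T D v on the compact unit sphere, with value l, makes D - l positive
  semidefinite with vanishing form at u; then \<open>psd_kernel\<close> applies.\<close>

lemma exists_min_eigenvector:
  fixes D :: "real^'a^'a"
  assumes sym: "transpose D = D"
  obtains u l where "norm u = 1" "D *v u = l *\<^sub>R u" "\<And>v. l * (v \<bullet> v) \<le> v \<bullet> (D *v v)"
proof -
  have "continuous_on (sphere 0 1) (\<lambda>v. v \<bullet> (D *v v))"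
    by (intro continuous_intros linear_continuous_on) (simp add: linear_linear)
  moreover have "sphere (0 :: real^'a) 1 \<noteq> {}"
    by simp
  ultimately obtain u where u: "norm u = 1"
    and min: "\<And>v. norm v = 1 \<Longrightarrow> u \<bullet> (D *v u) \<le> v \<bullet> (D *v v)"
    using continuous_attains_inf[of "sphere (0::real^'a) 1" "\<lambda>v. v \<bullet> (D *v v)"]
    by (auto simp: dist_norm)
  define l where "l = u \<bullet> (D *v u)"
  have ge: "l * (v \<bullet> v) \<le> v \<bullet> (D *v v)" for v
  proof (cases "v = 0")
    case False
    have "l \<le> (v /\<^sub>R norm v) \<bullet> (D *v (v /\<^sub>R norm v))"
      unfolding l_def by (rule min) (use False in simp)
    also have "\<dots> = (v \<bullet> (D *v v)) / (norm v)^2"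
      by (simp add: matrix_vector_mult_scaleR power2_eq_square divide_simps)
    finally show ?thesis
      using False by (simp add: field_simps dot_square_norm)
  qed simp
  have quad: "v \<bullet> ((D - l *\<^sub>R mat 1) *v v) = v \<bullet> (D *v v) - l * (v \<bullet> v)" for v
    by (simp add: matrix_vector_mult_diff_rdistrib mv_scaleR_left inner_diff_right)
  have "(D - l *\<^sub>R mat 1) *v u = 0"
  proof (rule psd_kernel)
    show "transpose (D - l *\<^sub>R mat 1) = D - l *\<^sub>R mat 1"
      by (simp add: transpose_diff transpose_scalar sym)
    show "0 \<le> v \<bullet> ((D - l *\<^sub>R mat 1) *v v)" for v
      using ge[of v] by (simp add: quad)
    show "u \<bullet> ((D - l *\<^sub>R mat 1) *v u) = 0"
      unfolding quad using u by (simp add: l_def dot_square_norm)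
  qed
  then show ?thesis
    using that[OF u _ ge] by (simp add: matrix_vector_mult_diff_rdistrib mv_scaleR_left)
qed

(* One step of a Cholesky decomposition clears a nonzero diagonal entry of C at the cost of a
   rank-one term w w^T / c. *)
lemma trace_mult_psd_nonneg:
  fixes C D :: "real^'a^'a"
  assumes "transpose C = C" "\<And>x. 0 \<le> x \<bullet> (C *v x)" and D: "\<And>x. 0 \<le> x \<bullet> (D *v x)"
  shows "0 \<le> trace (C ** D)"
  using assms(1,2)
proof (induction "card {i. C $ i $ i \<noteq> 0}" arbitrary: C rule: less_induct)
  case less
  have diag: "axis i 1 \<bullet> (C *v axis i 1) = C $ i $ i" for i
    by (simp add: inner_axis' mv_axis)
  \<comment> \<open>A zero diagonal entry puts the basis vector into the kernel, so the whole column
    is zero. Hence elimination creates no new nonzero diagonal entry.\<close>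
  have zero: "C $ j $ i = 0" if "C $ i $ i = 0" for i j
    using psd_kernel[OF less.prems, of "axis i 1"] that diag
    by (metis mv_axis zero_index)
  have C_sym: "C $ i $ j = C $ j $ i" for i j
    by (metis less.prems(1) transpose_def vec_lambda_beta)
  show ?case
  proof (cases "\<exists>i. C $ i $ i \<noteq> 0")
    case False
    then have "C = 0"
      by (simp add: vec_eq_iff zero)
    then show ?thesis
      by (simp add: trace_def)
  next
    case True
    then obtain i where i: "C $ i $ i \<noteq> 0" by blast
    define c where "c = C $ i $ i"
    have c: "c > 0"
      using i less.prems(2)[of "axis i 1"] diag[of i] by (simp add: c_def)
    define w where "w = C *v axis i 1"
    have wj: "w $ j = C $ j $ i" for j
      by (simp add: w_def mv_axis)
    define C' where "C' = C - (1 / c) *\<^sub>R outer w w"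
    have C'_diag: "C' $ j $ j = C $ j $ j - (C $ j $ i)\<^sup>2 / c" for j
      by (simp add: C'_def outer_def wj power2_eq_square)
    have "{j. C' $ j $ j \<noteq> 0} \<subset> {j. C $ j $ j \<noteq> 0}"
    proof
      show "{j. C' $ j $ j \<noteq> 0} \<subseteq> {j. C $ j $ j \<noteq> 0}"
        using zero C_sym by (auto simp: C'_diag)
      have "C' $ i $ i = 0"
        using c by (simp add: C'_diag c_def power2_eq_square)
      then show "{j. C' $ j $ j \<noteq> 0} \<noteq> {j. C $ j $ j \<noteq> 0}"
        using i by blast
    qed
    then have "card {j. C' $ j $ j \<noteq> 0} < card {j. C $ j $ j \<noteq> 0}"
      by (simp add: psubset_card_mono)
    moreover have "transpose C' = C'"
      by (simp add: C'_def transpose_diff transpose_scalar transpose_outer less.prems(1))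
    moreover have "0 \<le> x \<bullet> (C' *v x)" for x
    proof -
      \<comment> \<open>This r completes the square: the form of C' at x equals the form of C at x -
        r e_i.\<close>
      define r where "r = (w \<bullet> x) / c"
      have "axis i 1 \<bullet> (C *v x) = w \<bullet> x"
        using inner_transpose_mv[of "axis i 1" C x] less.prems(1) by (simp add: w_def)
      moreover have "axis i 1 \<bullet> w = c"
        by (simp add: w_def diag c_def)
      ultimately have "(x - r *\<^sub>R axis i 1) \<bullet> (C *v (x - r *\<^sub>R axis i 1))
          = x \<bullet> (C *v x) - 2 * r * (w \<bullet> x) + r\<^sup>2 * c"
        by (simp add: matrix_vector_mult_diff_distrib matrix_vector_mult_scaleR inner_diff_left
            inner_diff_right w_def[symmetric] inner_commute[of x w] power2_eq_square algebra_simps)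
      also have "\<dots> = x \<bullet> (C' *v x)"
        using c by (simp add: C'_def matrix_vector_mult_diff_rdistrib mv_scaleR_left outer_mv
            inner_diff_right r_def inner_commute[of x w] power2_eq_square field_simps)
      finally show ?thesis
        using less.prems(2) by metis
    qed
    ultimately have "0 \<le> trace (C' ** D)"
      by (rule less.hyps)
    moreover have "trace (C ** D) = trace (C' ** D) + (w \<bullet> (D *v w)) / c"
      by (simp add: C'_def mm_diff_left mm_scaleR_left outer_mm trace_sub trace_scaleR trace_outer
          inner_transpose_mv inner_commute)
    ultimately show ?thesis
      using c D[of w] by simp
  qed
qed

section \<open>Traces of congruences, a Sylvester equation, contractions\<close>

lemma trace_transpose_mm: "trace (transpose A ** B) = A \<bullet> B" for A B :: "real^'b^'a"
  unfolding trace_def transpose_def matrix_matrix_mult_def inner_vec_def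
  by (simp add: sum.swap[of _ "UNIV :: 'b set"])

lemma trace_congruence:
  "trace (transpose Y ** S ** Y) = (\<Sum>j\<in>UNIV. (Y *v axis j 1) \<bullet> (S *v (Y *v axis j 1)))"
  for Y :: "real^'b^'a"
  by (simp add: trace_eq_sum_inner matrix_vector_mul_assoc[symmetric] inner_transpose_mv)

lemma matrix_eq_zero_if_axis: "D = 0" if "\<And>j. D *v axis j 1 = 0" for D :: "real^'b^'a"
  using that mv_axis[of D] by (simp add: vec_eq_iff)

text \<open>Multiplying by D^T and taking traces gives tr (D^T A D) + tr (D B D^T) = 0. Both terms
  are nonnegative, so both vanish, and definiteness of A kills every column of D.\<close>

lemma sylvester_zero:
  fixes A :: "real^'a^'a" and B :: "real^'b^'b" and D :: "real^'b^'a"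
  assumes eq: "A ** D + D ** B = 0" and A: "\<And>x. x \<noteq> 0 \<Longrightarrow> 0 < x \<bullet> (A *v x)" and B: "\<And>x. 0 \<le> x \<bullet> (B *v x)"
  shows "D = 0"
proof -
  have "trace (transpose D ** (A ** D + D ** B)) = 0"
    by (simp add: eq trace_def)
  moreover have "trace (transpose D ** (D ** B)) = trace (transpose (transpose D) ** B ** transpose D)"
    using trace_mul_sym[of "transpose D" "D ** B"] by simp
  moreover have "0 \<le> trace (transpose (transpose D) ** B ** transpose D)"
    unfolding trace_congruence by (simp add: sum_nonneg B)
  ultimately have "trace (transpose D ** A ** D) \<le> 0"
    by (simp add: matrix_add_ldistrib trace_add matrix_mul_assoc)
  moreover have A0: "0 \<le> x \<bullet> (A *v x)" for x
    using A[of x] by (cases "x = 0") auto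
  ultimately have "(D *v axis j 1) \<bullet> (A *v (D *v axis j 1)) = 0" for j
    unfolding trace_congruence
    by (metis (no_types, lifting) A0 UNIV_I antisym finite sum_nonneg sum_nonneg_eq_0_iff)
  then show ?thesis
    by (intro matrix_eq_zero_if_axis) (metis A less_irrefl)
qed

text \<open>By Cauchy-Schwarz, |P^T v|^2 = v^T P (P^T v) is at most |v| |P^T v|.\<close>

lemma contraction_transpose:
  fixes P :: "real^'b^'a"
  assumes "\<And>v. norm (P *v v) \<le> norm v"
  shows "norm (transpose P *v v) \<le> norm v"
proof -
  have "(norm (transpose P *v v))\<^sup>2 = v \<bullet> (P *v (transpose P *v v))"
    using inner_transpose_mv[of "transpose P *v v" P v] by (simp add: dot_square_norm inner_commute)
  also have "\<dots> \<le> norm v * norm (transpose P *v v)"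
    by (meson assms mult_left_mono norm_cauchy_schwarz norm_ge_zero order_trans)
  finally show ?thesis
    by (cases "norm (transpose P *v v) = 0") (auto simp: power2_eq_square)
qed

section \<open>First-order and second-order conditions\<close>

text \<open>Polarization: evaluate the form at e_i, e_j and e_i + e_j.\<close>

lemma skew_if_quadratic_form_zero:
  fixes S :: "real^'a^'a"
  assumes "\<And>v. v \<bullet> (S *v v) = 0"
  shows "transpose S = - S"
proof -
  have "transpose S $ i $ j = (- S) $ i $ j" for i j
  proof -
    have "(axis i 1 + axis j 1) \<bullet> (S *v (axis i 1 + axis j 1)) = S $ i $ i + S $ i $ j + S $ j $ i + S $ j $ j"
      by (simp add: matrix_vector_right_distrib inner_add_left inner_add_right inner_axis' mv_axis)
    moreover have diag: "S $ l $ l = 0" for l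
      using assms[of "axis l 1"] by (simp add: inner_axis' mv_axis)
    ultimately show ?thesis
      using assms[of "axis i 1 + axis j 1"] diag[of i] diag[of j]
      unfolding transpose_def by simp
  qed
  then show ?thesis
    by (simp add: vec_eq_iff)
qed

section \<open>Local minimality along feasible curves\<close>

lemma local_minimizer_along_curve:
  fixes \<gamma> :: "real \<Rightarrow> 'a::topological_space"
  assumes "local_minimizer f S x" "continuous_on UNIV \<gamma>" "\<gamma> 0 = x" "\<And>t. \<gamma> t \<in> S"
  obtains d where "0 < d" "\<And>t. \<bar>t\<bar> < d \<Longrightarrow> f x \<le> f (\<gamma> t)"
proof -
  obtain T where T: "open T" "x \<in> T" "\<And>y. y \<in> S \<inter> T \<Longrightarrow> f x \<le> f y"
    using assms(1) unfolding local_minimizer_def openin_open by blast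
  have "open (\<gamma> -` T)"
    using assms(2) T(1) by (simp add: open_vimage)
  then obtain d where "0 < d" "ball 0 d \<subseteq> \<gamma> -` T"
    using T(2) assms(3) by (metis openE vimageI)
  then show ?thesis
    using that T(3) assms(4) by (auto simp: subset_iff dist_norm)
qed

lemma local_minimizer_in: "local_minimizer f S x \<Longrightarrow> x \<in> S"
  unfolding local_minimizer_def by (meson openin_imp_subset subsetD)

lemma trace_quadratic_expand:
  fixes M :: "real^'a^'a" and X E :: "real^'b^'a"
  assumes "transpose M = M"
  shows "trace (transpose (X + E) ** M ** (X + E)) =
    trace (transpose X ** M ** X) + 2 * trace (transpose X ** M ** E) + trace (transpose E ** M ** E)"
proof -
  have "trace (transpose E ** M ** X) = trace (transpose X ** M ** E)"
    using trace_transpose[of "transpose E ** M ** X"] by (simp add: mm_simps assms)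
  then show ?thesis
    by (simp add: mm_simps trace_add)
qed

text \<open>For each v the transvections 1 + t v v^T J give a feasible line through X. Vanishing of
  the first-order term for all v says that M X X^T J has zero quadratic form, hence is skew.\<close>

lemma stationary_lagrange:
  fixes M :: "real^('n::finite + 'n)^('n + 'n)" and X :: "real^('k::finite + 'k)^('n + 'n)"
  assumes sym: "transpose M = M"
    and loc: "local_minimizer (\<lambda>Y. trace (transpose Y ** M ** Y)) symplectic_feasible X"
  shows "J_mat ** X ** transpose X ** M = M ** X ** transpose X ** J_mat"
proof -
  have feas: "transpose X ** J_mat ** X = J_mat"
    using local_minimizer_in[OF loc] by (simp add: symplectic_feasible_def)
  have "v \<bullet> ((M ** X ** transpose X ** J_mat) *v v) = 0" for v
  proof -
    define E where "E = outer v v ** J_mat ** X"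
    \<comment> \<open>Since v^T J v = 0, the term of order t^2 in the constraint disappears and the
      straight line X + t E stays exactly feasible.\<close>
    have vJv: "outer v v ** J_mat ** outer v v = 0"
      by (simp add: outer_mm transpose_outer transpose_J mv_minus_left mv_minus_right outer_mv inner_J_self outer_zero)
    have EJE: "transpose E ** J_mat ** E = 0"
    proof -
      have "transpose E ** J_mat ** E
          = - transpose X ** J_mat ** (outer v v ** J_mat ** outer v v) ** J_mat ** X"
        by (simp add: E_def mm_simps J_simps transpose_outer)
      then show ?thesis
        by (simp add: vJv)
    qed
    have "transpose X ** J_mat ** E + transpose E ** J_mat ** X = 0"
      by (simp add: E_def mm_simps J_simps transpose_outer)
    moreover have "transpose (X + t *\<^sub>R E) ** J_mat ** (X + t *\<^sub>R E) = transpose X ** J_mat ** X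
        + t *\<^sub>R (transpose X ** J_mat ** E + transpose E ** J_mat ** X)
        + t\<^sup>2 *\<^sub>R (transpose E ** J_mat ** E)" for t
      by (simp add: mm_simps power2_eq_square scaleR_add_right)
    ultimately have "X + t *\<^sub>R E \<in> symplectic_feasible" for t
      using EJE feas by (simp add: symplectic_feasible_def)
    then obtain d where "0 < d"
      and d: "\<And>t. \<bar>t\<bar> < d \<Longrightarrow> trace (transpose X ** M ** X)
        \<le> trace (transpose (X + t *\<^sub>R E) ** M ** (X + t *\<^sub>R E))"
      by (rule local_minimizer_along_curve[OF loc, of "\<lambda>t. X + t *\<^sub>R E", rotated 2])
        (auto intro!: continuous_intros)
    have "2 * trace (transpose X ** M ** E) = 0"
    proof (rule linear_coeff_zero[OF \<open>0 < d\<close>])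
      fix t :: real assume "\<bar>t\<bar> < d"
      then show "0 \<le> 2 * trace (transpose X ** M ** E) * t + trace (transpose E ** M ** E) * t\<^sup>2"
        using d[of t] unfolding trace_quadratic_expand[OF sym]
        by (simp add: transpose_scalar mm_scaleR_left mm_scaleR_right trace_scaleR power2_eq_square algebra_simps)
    qed
    moreover have "trace (transpose X ** M ** E) = - (v \<bullet> ((M ** X ** transpose X ** J_mat) *v v))"
    proof -
      have "trace (transpose X ** M ** E) = - ((transpose X *v (M *v v)) \<bullet> (transpose X *v (J_mat *v v)))"
        by (simp add: E_def mm_outer outer_mm trace_outer mm_simps J_simps mv_minus_left mv_minus_right
            matrix_vector_mul_assoc[symmetric])
      also have "(transpose X *v (M *v v)) \<bullet> (transpose X *v (J_mat *v v))
          = v \<bullet> ((M ** X ** transpose X ** J_mat) *v v)"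
      proof -
        define y where "y = transpose X *v (J_mat *v v)"
        have "(transpose X *v (M *v v)) \<bullet> y = (X *v y) \<bullet> (M *v v)"
          using inner_transpose_mv[of y X "M *v v"] by (simp only: inner_commute)
        also have "\<dots> = v \<bullet> (M *v (X *v y))"
          using inner_transpose_mv[of "X *v y" M v] by (simp only: sym inner_commute)
        finally show ?thesis
          by (simp add: y_def matrix_vector_mul_assoc matrix_mul_assoc)
      qed
      finally show ?thesis .
    qed
    ultimately show ?thesis by simp
  qed
  then have "transpose (M ** X ** transpose X ** J_mat) = - (M ** X ** transpose X ** J_mat)"
    by (rule skew_if_quadratic_form_zero)
  then show ?thesis
    by (simp add: mm_simps J_simps sym)
qed

text \<open>Multiply the Lagrange identity by J on the left and X on the right and use X^T J X = J
  to get J M X = X A J. Multiplying this by X^T J yields - A = J A J, which is the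
  commutation.\<close>

lemma stationary:
  fixes M :: "real^('n::finite + 'n)^('n + 'n)" and X :: "real^('k::finite + 'k)^('n + 'n)"
  assumes sym: "transpose M = M"
    and loc: "local_minimizer (\<lambda>Y. trace (transpose Y ** M ** Y)) symplectic_feasible X"
  defines "A \<equiv> transpose X ** M ** X"
  shows "J_mat ** M ** X = X ** J_mat ** A" "A ** J_mat = J_mat ** A"
proof -
  have feas: "transpose X ** (J_mat ** X) = J_mat"
    using local_minimizer_in[OF loc] by (simp add: symplectic_feasible_def mm_simps)
  have "J_mat ** (J_mat ** X ** transpose X ** M) ** X = J_mat ** (M ** X ** transpose X ** J_mat) ** X"
    by (simp only: stationary_lagrange[OF sym loc])
  then have "J_mat ** M ** X ** J_mat = - (X ** A)"
    by (simp add: mm_simps J_simps feas A_def)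
  then have "J_mat ** M ** X ** J_mat ** J_mat = - (X ** A) ** J_mat"
    by simp
  then have *: "J_mat ** M ** X = X ** A ** J_mat"
    by (simp add: mm_simps J_simps)
  then have "transpose X ** J_mat ** (J_mat ** M ** X) = transpose X ** J_mat ** (X ** A ** J_mat)"
    by simp
  then have "- A = transpose X ** (J_mat ** X) ** A ** J_mat"
    by (simp add: mm_simps J_simps A_def)
  then have "J_mat ** - A = J_mat ** (J_mat ** A ** J_mat)"
    by (simp add: feas)
  then show comm: "A ** J_mat = J_mat ** A"
    by (simp add: mm_simps J_simps)
  show "J_mat ** M ** X = X ** J_mat ** A"
    using * comm by (simp add: mm_simps)
qed

section \<open>Rotating an eigenplane into the complement\<close>

lemma norm_J_mv: "norm (J_mat *v x) = norm x"
  by (simp add: norm_eq_sqrt_inner inner_J_skew J_J_mv)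

text \<open>The factor 1 + a P scales the range of the projection P by 1 + a. As S commutes with P,
  it is scaled there by (1 + a)^2 and is unchanged on the kernel.\<close>

lemma projection_congruence:
  "(mat 1 + a *\<^sub>R P) ** S ** (mat 1 + a *\<^sub>R P) = S + (2 * a + a\<^sup>2) *\<^sub>R (S ** P)"
  if PS: "P ** S = S ** P" and PP: "P ** P = P" for P S :: "real^'a^'a"
proof -
  have "(mat 1 + a *\<^sub>R P) ** S ** (mat 1 + a *\<^sub>R P) = S + a *\<^sub>R (S ** P) + a *\<^sub>R (S ** P) + (a * a) *\<^sub>R (S ** P ** P)"
    by (simp only: mm_add_left matrix_add_ldistrib mm_scaleR_left mm_scaleR_right PS matrix_mul_lid
        matrix_mul_rid scaleR_right_distrib scaleR_scaleR add.assoc)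
  then show ?thesis
    by (simp only: matrix_mul_assoc[symmetric] PP) (simp only: power2_eq_square scaleR_left_distrib mult_2 add.assoc)
qed

text \<open>The curve turns X u into z and X u' into z' through the angle t and fixes X on the
  orthogonal complement of u, u'. The objective changes by exactly (sin t)^2 times the difference of
  the two sides.\<close>

lemma second_order_normalized:
  fixes M :: "real^('n::finite + 'n)^('n + 'n)" and X :: "real^('k::finite + 'k)^('n + 'n)"
  assumes sym: "transpose M = M"
    and loc: "local_minimizer (\<lambda>Y. trace (transpose Y ** M ** Y)) symplectic_feasible X"
    and u: "norm u = 1" "(transpose X ** M ** X) *v u = d *\<^sub>R u"
    and z: "(transpose X ** J_mat) *v z = 0" "(transpose X ** J_mat) *v z' = 0" "z \<bullet> (J_mat *v z') = 1"
  shows "2 * d \<le> z \<bullet> (M *v z) + z' \<bullet> (M *v z')"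
proof -
  define A where "A = transpose X ** M ** X"
  note comm = stationary(2)[OF sym loc, folded A_def]
  have feas: "transpose X ** J_mat ** X = J_mat"
    using local_minimizer_in[OF loc] by (simp add: symplectic_feasible_def)
  \<comment> \<open>The partner of u: u^T J u' = 1, matching z^T J z' = 1, and u' has the same
    eigenvalue d because A commutes with J.\<close>
  define u' where "u' = - (J_mat *v u)"
  have Ju: "J_mat *v u = - u'" and Ju': "J_mat *v u' = u"
    by (simp_all add: u'_def mv_minus_right J_J_mv)
  have uu: "u \<bullet> u = 1" "u' \<bullet> u' = 1" "u \<bullet> u' = 0" "u' \<bullet> u = 0"
    using u(1) norm_J_mv[of u] inner_J_self[of u]
    by (simp_all add: u'_def dot_square_norm inner_commute)
  have Au: "A *v u = d *\<^sub>R u" "A *v u' = d *\<^sub>R u'"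
  proof -
    show "A *v u = d *\<^sub>R u"
      using u(2) by (simp add: A_def)
    then have "(A ** J_mat) *v u = d *\<^sub>R (J_mat *v u)"
      by (simp add: comm matrix_vector_mul_assoc[symmetric] matrix_vector_mult_scaleR)
    then show "A *v u' = d *\<^sub>R u'"
      by (simp add: u'_def matrix_vector_mul_assoc[symmetric] mv_minus_right)
  qed
  \<comment> \<open>P is the orthogonal projection onto the plane of u, u'; E sends u to z, u' to z'
    and the orthogonal complement to 0.\<close>
  define P where "P = outer u u + outer u' u'"
  define E where "E = outer z u + outer z' u'"
  have PP: "P ** P = P"
    by (simp add: P_def mm_add_left matrix_add_ldistrib outer_mm_outer uu)
  have P_sym: "transpose P = P"
    by (simp add: P_def transpose_add transpose_outer)
  have JP: "J_mat ** P = outer u u' - outer u' u"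
    by (simp add: P_def matrix_add_ldistrib mm_outer Ju Ju' outer_minus_left)
  have PJ: "P ** J_mat = J_mat ** P"
    unfolding JP by (simp add: P_def mm_add_left outer_mm transpose_J mv_minus_left Ju Ju' outer_minus_right)
  have AP: "trace (A ** P) = 2 * d"
    by (simp add: P_def matrix_add_ldistrib mm_outer trace_add trace_outer Au uu)
  have XJE: "transpose X ** J_mat ** E = 0"
    by (simp add: E_def matrix_add_ldistrib mm_outer z outer_zero)
  have EJX: "transpose E ** J_mat ** X = 0"
    using arg_cong[OF XJE, of transpose] by (simp add: mm_simps J_simps transpose_zero)
  have EJE: "transpose E ** J_mat ** E = J_mat ** P"
  proof -
    have "(J_mat *v z) \<bullet> z' = - 1" "(J_mat *v z') \<bullet> z = 1"
      using z(3) inner_J_skew[of z z'] by (simp_all add: inner_commute)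
    then show ?thesis
      unfolding JP
      by (simp add: E_def transpose_add transpose_outer mm_add_left matrix_add_ldistrib outer_mm
          transpose_J mv_minus_left outer_minus_right mm_diff_left mm_minus_left outer_mv mv_minus_right
          outer_scaleR outer_zero transpose_outer inner_J_self inner_commute[of "J_mat *v _"])
  qed
  \<comment> \<open>Stationarity gives X^T M J = A J X^T, so the M-cross term reduces to the J-cross
    term X^T J E, which is zero.\<close>
  have XME: "transpose X ** M ** E = 0"
  proof -
    have "transpose (J_mat ** M ** X) = transpose (X ** J_mat ** A)"
      using stationary(1)[OF sym loc] by (simp add: A_def)
    moreover have "transpose A = A"
      by (simp add: A_def mm_simps sym)
    ultimately have "transpose X ** M ** J_mat = A ** J_mat ** transpose X"
      by (simp add: mm_simps J_simps sym)
    then have "transpose X ** M ** J_mat ** (J_mat ** E) = A ** J_mat ** transpose X ** (J_mat ** E)"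
      by simp
    also have "\<dots> = A ** J_mat ** (transpose X ** J_mat ** E)"
      by (simp add: mm_simps)
    finally show ?thesis
      by (simp only: XJE times0_right) (simp add: mm_simps J_simps)
  qed
  have EME: "trace (transpose E ** M ** E) = z \<bullet> (M *v z) + z' \<bullet> (M *v z')"
    by (simp add: E_def transpose_add transpose_outer mm_add_left matrix_add_ldistrib outer_mm
        sym trace_add trace_outer outer_mv transpose_outer inner_add_right uu)
  \<comment> \<open>With this coefficient X + a X P is cos t X on the plane and X off it; the loss -
    (sin t)^2 is balanced by the contribution of sin t E.\<close>
  define a where "a t = cos t - 1" for t :: real
  have a: "2 * a t + (a t)\<^sup>2 = - (sin t)\<^sup>2" for t
    using sin_cos_squared_add[of t] by (simp add: a_def power2_eq_square algebra_simps)
  define \<gamma> where "\<gamma> t = X + a t *\<^sub>R (X ** P) + sin t *\<^sub>R E" for t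
  \<comment> \<open>Used with S = J for feasibility and with S = M for the objective.\<close>
  have expand: "transpose (\<gamma> t) ** S ** \<gamma> t = (mat 1 + a t *\<^sub>R P) ** (transpose X ** S ** X) ** (mat 1 + a t *\<^sub>R P)
      + (sin t)\<^sup>2 *\<^sub>R (transpose E ** S ** E)"
    if "transpose X ** S ** E = 0" "transpose E ** S ** X = 0" for t and S :: "real^('n + 'n)^('n + 'n)"
  proof -
    define Q where "Q = mat 1 + a t *\<^sub>R P"
    have "\<gamma> t = X ** Q + sin t *\<^sub>R E"
      by (simp add: \<gamma>_def Q_def matrix_add_ldistrib mm_scaleR_right)
    moreover have "transpose Q = Q"
      by (simp add: Q_def transpose_add transpose_scalar P_sym)
    ultimately have "transpose (\<gamma> t) ** S ** \<gamma> t = Q ** (transpose X ** S ** X) ** Q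
        + sin t *\<^sub>R (Q ** (transpose X ** S ** E)) + sin t *\<^sub>R (transpose E ** S ** X ** Q)
        + (sin t)\<^sup>2 *\<^sub>R (transpose E ** S ** E)"
      by (simp add: mm_simps power2_eq_square scaleR_add_right)
    then show ?thesis
      by (simp add: that Q_def)
  qed
  have \<gamma>_feas: "\<gamma> t \<in> symplectic_feasible" for t
  proof -
    have "transpose (\<gamma> t) ** J_mat ** \<gamma> t = J_mat + (2 * a t + (a t)\<^sup>2 + (sin t)\<^sup>2) *\<^sub>R (J_mat ** P)"
      unfolding expand[OF XJE EJX] feas EJE projection_congruence[OF PJ PP] by (simp only: scaleR_left_distrib add.assoc)
    then show ?thesis
      by (simp add: symplectic_feasible_def a)
  qed
  have "continuous_on UNIV \<gamma>" "\<gamma> 0 = X"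
    unfolding \<gamma>_def a_def by (auto intro!: continuous_intros)
  then obtain e where "0 < e"
    and e: "\<And>t. \<bar>t\<bar> < e \<Longrightarrow> trace A \<le> trace (transpose (\<gamma> t) ** M ** \<gamma> t)"
    unfolding A_def by (rule local_minimizer_along_curve[OF loc _ _ \<gamma>_feas]) blast
  \<comment> \<open>A single t with sin t nonzero inside the neighbourhood suffices, since the
    change of the objective is an exact multiple of (sin t)^2.\<close>
  define t where "t = min (e / 2) 1"
  have t: "0 < t" "t < pi" "\<bar>t\<bar> < e"
    using \<open>0 < e\<close> pi_gt3 by (auto simp: t_def)
  have EMX: "transpose E ** M ** X = 0"
    using arg_cong[OF XME, of transpose] by (simp add: mm_simps sym transpose_zero)
  have "trace (P ** A ** P) = trace (A ** P)"
    using trace_mul_sym[of "P ** A" P] trace_mul_sym[of P A] by (simp add: matrix_mul_assoc PP)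
  then have "trace ((mat 1 + a t *\<^sub>R P) ** A ** (mat 1 + a t *\<^sub>R P)) = trace A + (2 * a t + (a t)\<^sup>2) * trace (A ** P)"
    using trace_mul_sym[of P A]
    by (simp add: mm_add_left matrix_add_ldistrib mm_scaleR_left mm_scaleR_right trace_add trace_scaleR
        power2_eq_square algebra_simps)
  then have "trace ((mat 1 + a t *\<^sub>R P) ** A ** (mat 1 + a t *\<^sub>R P)) = trace A - (sin t)\<^sup>2 * (2 * d)"
    by (simp add: a AP)
  then have "trace (transpose (\<gamma> t) ** M ** \<gamma> t)
      = trace A + (sin t)\<^sup>2 * (z \<bullet> (M *v z) + z' \<bullet> (M *v z') - 2 * d)"
    by (simp add: expand[OF XME EMX] A_def[symmetric] trace_add trace_scaleR EME right_diff_distrib)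
  then have "0 \<le> (sin t)\<^sup>2 * (z \<bullet> (M *v z) + z' \<bullet> (M *v z') - 2 * d)"
    using e[OF t(3)] by simp
  moreover have "0 < (sin t)\<^sup>2"
    using sin_gt_zero[OF t(1,2)] by simp
  ultimately show ?thesis
    by (simp add: zero_le_mult_iff)
qed

text \<open>For positive z^T J z', rescale both vectors by the inverse square root of this number.
  Otherwise the left side is nonpositive, as d \<ge> 0, and the right side is nonnegative.\<close>

lemma second_order:
  fixes M :: "real^('n::finite + 'n)^('n + 'n)" and X :: "real^('k::finite + 'k)^('n + 'n)"
  assumes sym: "transpose M = M" and psd: "\<And>x. 0 \<le> x \<bullet> (M *v x)"
    and loc: "local_minimizer (\<lambda>Y. trace (transpose Y ** M ** Y)) symplectic_feasible X"
    and u: "norm u = 1" "(transpose X ** M ** X) *v u = d *\<^sub>R u"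
    and z: "(transpose X ** J_mat) *v z = 0" "(transpose X ** J_mat) *v z' = 0"
  shows "2 * d * (z \<bullet> (J_mat *v z')) \<le> z \<bullet> (M *v z) + z' \<bullet> (M *v z')"
proof (cases "0 < z \<bullet> (J_mat *v z')")
  case True
  define r where "r = z \<bullet> (J_mat *v z')"
  define s where "s = 1 / sqrt r"
  have s: "s * s = 1 / r" and r: "0 < r"
    using True by (auto simp: s_def r_def)
  have "2 * d \<le> (s *\<^sub>R z) \<bullet> (M *v (s *\<^sub>R z)) + (s *\<^sub>R z') \<bullet> (M *v (s *\<^sub>R z'))"
    by (rule second_order_normalized[OF sym loc u])
      (use r z in \<open>auto simp: matrix_vector_mult_scaleR mult.assoc[symmetric] s r_def[symmetric]\<close>)
  also have "\<dots> = (z \<bullet> (M *v z) + z' \<bullet> (M *v z')) / r"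
    by (simp add: matrix_vector_mult_scaleR mult.assoc[symmetric] s add_divide_distrib)
  finally show ?thesis
    using r by (simp add: r_def[symmetric] field_simps)
next
  case False
  have "d = u \<bullet> ((transpose X ** M ** X) *v u)"
    using u by (simp add: dot_square_norm)
  also have "\<dots> = (X *v u) \<bullet> (M *v (X *v u))"
    by (simp add: matrix_vector_mul_assoc[symmetric] inner_transpose_mv)
  finally have "0 \<le> d"
    using psd by simp
  then have "2 * d * (z \<bullet> (J_mat *v z')) \<le> 0"
    using False by (simp add: mult_nonneg_nonpos)
  then show ?thesis
    using psd[of z] psd[of z'] by linarith
qed

section \<open>Comparison with a global minimizer\<close>

text \<open>The least eigenvalue c of M is positive and the objective is at least c |Y|^2. Outside
  the ball of radius r it thus exceeds its value at a chosen point X of S, and the part of S inside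
  the ball is compact.\<close>

lemma exists_global_minimizer:
  fixes M :: "real^'a^'a" and S :: "(real^'b^'a) set"
  assumes "sym_pos_def M" "closed S" "S \<noteq> {}"
  shows "\<exists>Y. global_minimizer (\<lambda>Y. trace (transpose Y ** M ** Y)) S Y"
proof -
  let ?f = "\<lambda>Y :: real^'b^'a. trace (transpose Y ** M ** Y)"
  have sym: "transpose M = M" and pos: "\<And>x. x \<noteq> 0 \<Longrightarrow> 0 < x \<bullet> (M *v x)"
    using assms(1) by (auto simp: sym_pos_def_def)
  obtain u c where u: "norm u = 1" "M *v u = c *\<^sub>R u" and c: "\<And>v. c * (v \<bullet> v) \<le> v \<bullet> (M *v v)"
    by (rule exists_min_eigenvector[OF sym]) blast
  have "0 < c"
    using pos[of u] u by (fastforce simp: dot_square_norm)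
  have ge: "c * (norm Y)\<^sup>2 \<le> ?f Y" for Y
  proof -
    have "c * (norm Y)\<^sup>2 = c * trace (transpose Y ** mat 1 ** Y)"
      by (simp add: trace_transpose_mm dot_square_norm)
    also have "\<dots> \<le> ?f Y"
      unfolding trace_congruence by (simp add: sum_distrib_left sum_mono c)
    finally show ?thesis .
  qed
  obtain X where X: "X \<in> S"
    using assms(3) by blast
  define r where "r = sqrt (?f X / c)"
  have fX: "0 \<le> ?f X"
    using ge[of X] \<open>0 < c\<close> by (meson less_imp_le mult_nonneg_nonneg order_trans zero_le_power2)
  have "norm X \<le> r"
    using ge[of X] \<open>0 < c\<close> by (simp add: r_def real_le_rsqrt field_simps)
  have cont: "continuous_on (S \<inter> cball 0 r) ?f"
  proof -
    have "linear (\<lambda>Y :: real^'b^'a. M ** Y)"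
      by (rule linearI) (simp_all add: matrix_add_ldistrib mm_scaleR_right)
    then have "continuous_on (S \<inter> cball 0 r) (\<lambda>Y :: real^'b^'a. M ** Y)"
      by (simp add: linear_continuous_on linear_linear)
    then show ?thesis
      unfolding matrix_mul_assoc[symmetric] trace_transpose_mm by (intro continuous_intros)
  qed
  have "compact (S \<inter> cball 0 r)"
    using assms(2) by (simp add: closed_Int_compact)
  moreover have "S \<inter> cball 0 r \<noteq> {}"
    using X \<open>norm X \<le> r\<close> by auto
  ultimately have "\<exists>Y\<in>S \<inter> cball 0 r. \<forall>W\<in>S \<inter> cball 0 r. ?f Y \<le> ?f W"
    using cont by (rule continuous_attains_inf)
  then obtain Y where Y: "Y \<in> S \<inter> cball 0 r" and Y_min: "\<forall>W\<in>S \<inter> cball 0 r. ?f Y \<le> ?f W"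
    by (rule bexE)
  have min: "?f Y \<le> ?f W" if "W \<in> S" "norm W \<le> r" for W
    by (rule bspec[OF Y_min]) (simp add: that)
  have "?f Y \<le> ?f W" if W: "W \<in> S" for W
  proof (cases "norm W \<le> r")
    case False
    then have "?f X / c < (norm W)\<^sup>2"
      using fX \<open>0 < c\<close> by (simp add: r_def real_sqrt_less_iff real_less_lsqrt not_le) (metis linorder_not_le real_le_rsqrt)
    then have "?f X < ?f W"
      using ge[of W] \<open>0 < c\<close> by (simp add: field_simps)
    then show ?thesis
      using min[OF X \<open>norm X \<le> r\<close>] by linarith
  qed (use min W in blast)
  then show ?thesis
    using Y by (auto simp: global_minimizer_def)
qed

section \<open>The feasible set and compressions to it\<close>

lemma closed_symplectic_feasible: "closed (symplectic_feasible :: (real^('k::finite + 'k)^('n::finite + 'n)) set)"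
  unfolding symplectic_feasible_def vec_eq_iff matrix_matrix_mult_def transpose_def
  by (simp add: closed_Collect_all closed_Collect_eq continuous_intros)

lemma global_imp_local_minimizer: "global_minimizer f S x \<Longrightarrow> local_minimizer f S x"
  unfolding global_minimizer_def local_minimizer_def by (metis openin_subtopology_self)

text \<open>X is injective, because X^T J X = J is.\<close>

lemma pos_def_compression:
  fixes M :: "real^('n::finite + 'n)^('n + 'n)" and X :: "real^('k::finite + 'k)^('n + 'n)"
  assumes pos: "\<And>x. x \<noteq> 0 \<Longrightarrow> 0 < x \<bullet> (M *v x)" and X: "X \<in> symplectic_feasible" and "x \<noteq> 0"
  shows "0 < x \<bullet> ((transpose X ** M ** X) *v x)"
proof -
  have "transpose X *v (J_mat *v (X *v x)) = J_mat *v x"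
    using X by (simp add: symplectic_feasible_def matrix_vector_mul_assoc matrix_mul_assoc)
  moreover have "J_mat *v x \<noteq> 0"
    using \<open>x \<noteq> 0\<close> norm_J_mv[of x] by auto
  ultimately have "X *v x \<noteq> 0"
    by auto
  then show ?thesis
    using pos by (simp add: matrix_vector_mul_assoc[symmetric] inner_transpose_mv)
qed

text \<open>Applied below with a global minimizer Y. X enters through its first-order and
  second-order conditions, Y through stationarity.\<close>

lemma local_minimizer_le_global:
  fixes M :: "real^('n::finite + 'n)^('n + 'n)" and X Y :: "real^('k::finite + 'k)^('n + 'n)"
  assumes "sym_pos_def M"
    and locX: "local_minimizer (\<lambda>Y. trace (transpose Y ** M ** Y)) symplectic_feasible X"
    and locY: "local_minimizer (\<lambda>Y. trace (transpose Y ** M ** Y)) symplectic_feasible Y"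
  shows "trace (transpose X ** M ** X) \<le> trace (transpose Y ** M ** Y)"
proof -
  have sym: "transpose M = M" and pos: "\<And>x. x \<noteq> 0 \<Longrightarrow> 0 < x \<bullet> (M *v x)"
    using assms(1) by (auto simp: sym_pos_def_def)
  then have psd: "0 \<le> x \<bullet> (M *v x)" for x
    by (cases "x = 0") (auto simp: less_imp_le)
  define A B where "A = transpose X ** M ** X" and "B = transpose Y ** M ** Y"
  note JMX = stationary(1)[OF sym locX, folded A_def] and AJ = stationary(2)[OF sym locX, folded A_def]
    and JMY = stationary(1)[OF sym locY, folded B_def] and BJ = stationary(2)[OF sym locY, folded B_def]
  have X: "X \<in> symplectic_feasible" and Y: "Y \<in> symplectic_feasible"
    using locX locY by (auto dest: local_minimizer_in)
  then have XJX: "transpose X ** J_mat ** X = J_mat" and YJY: "transpose Y ** J_mat ** Y = J_mat"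
    by (auto simp: symplectic_feasible_def)
  have A_sym: "transpose A = A" and B_sym: "transpose B = B"
    by (simp_all add: A_def B_def mm_simps sym)
  have A_pos: "x \<noteq> 0 \<Longrightarrow> 0 < x \<bullet> (A *v x)" and B_pos: "x \<noteq> 0 \<Longrightarrow> 0 < x \<bullet> (B *v x)" for x
    using pos_def_compression[OF pos] X Y by (auto simp: A_def B_def)
  then have B_psd: "0 \<le> x \<bullet> (B *v x)" for x
    by (cases "x = 0") (auto simp: less_imp_le)

  \<comment> \<open>- J X^T J is a left inverse of X, so X P is the J-orthogonal projection of Y
    onto the range of X and Z is the remainder.\<close>
  define P where "P = - (J_mat ** transpose X ** J_mat ** Y)"
  define Z where "Z = Y - X ** P"
  have XJY: "transpose X ** J_mat ** Y = J_mat ** P"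
    by (simp add: P_def mm_simps J_simps)
  have XJZ: "transpose X ** J_mat ** Z = 0"
  proof -
    have "transpose X ** J_mat ** Z = transpose X ** J_mat ** Y - transpose X ** J_mat ** X ** P"
      by (simp add: Z_def mm_diff_right matrix_mul_assoc)
    then show ?thesis
      by (simp add: XJX XJY)
  qed
  \<comment> \<open>Both sides equal J X^T M Y, evaluated once with the stationarity of X and once
    with that of Y.\<close>
  have JAP: "J_mat ** A ** P = P ** J_mat ** B"
  proof -
    have "transpose (J_mat ** M ** X) = transpose (X ** J_mat ** A)"
      by (simp only: JMX)
    then have XMJ: "transpose X ** M ** J_mat = A ** J_mat ** transpose X"
      by (simp add: mm_simps J_simps sym A_sym)
    have "P ** J_mat ** B = - (J_mat ** transpose X ** J_mat ** (Y ** J_mat ** B))"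
      by (simp add: P_def mm_simps)
    also have "\<dots> = J_mat ** (transpose X ** M) ** Y"
      unfolding JMY[symmetric] by (simp add: mm_simps J_simps)
    also have "transpose X ** M = - (A ** J_mat ** transpose X ** J_mat)"
      unfolding XMJ[symmetric] by (simp add: mm_simps J_simps)
    also have "J_mat ** - (A ** J_mat ** transpose X ** J_mat) ** Y = J_mat ** A ** P"
      by (simp add: P_def mm_simps)
    finally show ?thesis ..
  qed
  \<comment> \<open>Using the previous identity twice gives A^2 P = P B^2, a Sylvester equation for
    A P - P B with positive definite coefficients.\<close>
  have AP: "A ** P = P ** B"
  proof -
    have "J_mat ** A ** (J_mat ** A ** P) = J_mat ** A ** (P ** J_mat ** B)"
      by (simp only: JAP)
    also have "\<dots> = J_mat ** A ** P ** (J_mat ** B)"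
      by (simp add: mm_simps)
    also have "\<dots> = P ** J_mat ** B ** (J_mat ** B)"
      by (simp only: JAP)
    also have "\<dots> = P ** J_mat ** (B ** J_mat) ** B"
      by (simp add: mm_simps)
    also have "\<dots> = - (P ** B ** B)"
      by (simp add: BJ mm_simps J_simps)
    also have "J_mat ** A ** (J_mat ** A ** P) = J_mat ** (A ** J_mat) ** A ** P"
      by (simp add: mm_simps)
    also have "\<dots> = - (A ** A ** P)"
      by (simp add: AJ mm_simps J_simps)
    finally have "A ** A ** P = P ** B ** B"
      by simp
    then have "A ** (A ** P - P ** B) + (A ** P - P ** B) ** B = 0"
      by (simp add: mm_diff_left mm_diff_right matrix_mul_assoc)
    from sylvester_zero[OF this A_pos B_psd] show ?thesis
      by simp
  qed
  \<comment> \<open>Now (J P - P J) B = 0. Transposed, this is a Sylvester equation with left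
    coefficient B and right coefficient 0.\<close>
  have JP: "J_mat ** P = P ** J_mat"
  proof -
    have "(J_mat ** P - P ** J_mat) ** B = J_mat ** (P ** B) - P ** J_mat ** B"
      by (simp add: mm_diff_left matrix_mul_assoc)
    also have "\<dots> = 0"
      by (simp add: AP[symmetric] JAP[symmetric] matrix_mul_assoc)
    finally have "transpose ((J_mat ** P - P ** J_mat) ** B) = 0"
      by (simp add: transpose_zero)
    then have "B ** transpose (J_mat ** P - P ** J_mat) + transpose (J_mat ** P - P ** J_mat) ** 0 = 0"
      by (simp add: matrix_transpose_mul B_sym)
    from sylvester_zero[OF this B_pos] have "transpose (J_mat ** P - P ** J_mat) = 0"
      by simp
    then show ?thesis
      by (metis eq_iff_diff_eq_0 transpose_transpose transpose_zero)
  qed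
  have JPt: "J_mat ** transpose P = transpose P ** J_mat"
    using arg_cong[OF JP, of transpose] by (simp add: matrix_transpose_mul transpose_J mm_minus_left mm_minus_right)

  define R where "R = mat 1 - transpose P ** P"
  have R_sym: "transpose R = R"
    by (simp add: R_def transpose_diff matrix_transpose_mul)
  have RJ: "R ** J_mat = J_mat ** R"
  proof -
    have "transpose P ** P ** J_mat = J_mat ** (transpose P ** P)"
      by (simp only: matrix_mul_assoc[symmetric] JP[symmetric]) (simp only: matrix_mul_assoc JPt)
    then show ?thesis
      by (simp add: R_def mm_diff_left mm_diff_right)
  qed
  \<comment> \<open>Z is J-orthogonal to the range of X, so this is Y^T J Y - P^T X^T J Y = J - P^T
    J P, and P commutes with J.\<close>
  have ZJZ: "transpose Z ** J_mat ** Z = R ** J_mat"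
  proof -
    have ZJX: "transpose Z ** J_mat ** X = 0"
      using arg_cong[OF XJZ, of transpose] by (simp add: mm_simps J_simps transpose_zero)
    have "transpose Z ** J_mat ** Z = transpose Z ** J_mat ** Y - transpose Z ** J_mat ** X ** P"
      by (subst (2) Z_def) (simp add: mm_diff_right matrix_mul_assoc)
    also have "\<dots> = transpose Y ** J_mat ** Y - transpose P ** (transpose X ** J_mat ** Y)"
      unfolding ZJX by (simp add: Z_def mm_simps)
    also have "\<dots> = R ** J_mat"
      by (simp add: XJY YJY R_def mm_diff_left) (simp add: JP mm_simps)
    finally show ?thesis .
  qed
  define T where "T = transpose Z ** M ** Z"
  \<comment> \<open>The two stationarity equations and \<open>JAP\<close> combine to J M Z = Z J B,
    so Z^T M Z reduces to Z^T J Z.\<close>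
  have T: "T = R ** B"
  proof -
    have "J_mat ** M ** Z = J_mat ** M ** Y - J_mat ** M ** X ** P"
      by (simp add: Z_def mm_diff_right matrix_mul_assoc)
    also have "\<dots> = Y ** J_mat ** B - X ** (J_mat ** A ** P)"
      unfolding JMX JMY by (simp add: mm_simps)
    also have "\<dots> = Z ** (J_mat ** B)"
      unfolding JAP by (simp add: Z_def mm_simps)
    finally have "J_mat ** (J_mat ** M ** Z) = J_mat ** (Z ** (J_mat ** B))"
      by simp
    then have "M ** Z = - (J_mat ** Z ** J_mat ** B)"
      by (simp add: mm_simps J_simps) (metis minus_minus)
    then have "T = - (transpose Z ** J_mat ** Z ** J_mat ** B)"
      by (simp add: T_def mm_simps)
    then show ?thesis
      unfolding ZJZ by (simp add: mm_simps J_simps)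
  qed
  have TJ: "T ** J_mat = J_mat ** T"
    unfolding T by (metis BJ RJ matrix_mul_assoc)

  \<comment> \<open>The largest eigenvalue d of A is minus the least eigenvalue of - A.\<close>
  obtain u l where u: "norm u = 1" "(- A) *v u = l *\<^sub>R u" and l: "\<And>v. l * (v \<bullet> v) \<le> v \<bullet> ((- A) *v v)"
    by (rule exists_min_eigenvector[of "- A"]) (auto simp: transpose_minus A_sym)
  define d where "d = - l"
  have Au: "A *v u = d *\<^sub>R u"
    using u(2) unfolding d_def mv_minus_left by (metis minus_equation_iff scaleR_minus_left)
  have A_le: "v \<bullet> (A *v v) \<le> d * (v \<bullet> v)" for v
    using l[of v] by (simp add: d_def mv_minus_left)

  \<comment> \<open>The second-order condition for z = Z e and z' = - Z J e: their J-pairing is e^T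
    R e, and both M-terms equal e^T T e because T commutes with J.\<close>
  have "d * (e \<bullet> (R *v e)) \<le> e \<bullet> (T *v e)" for e
  proof -
    have XJZv: "(transpose X ** J_mat) *v (Z *v x) = 0" for x
      by (simp add: matrix_vector_mul_assoc XJZ)
    have le: "2 * d * ((Z *v e) \<bullet> (J_mat *v - (Z *v (J_mat *v e))))
        \<le> (Z *v e) \<bullet> (M *v (Z *v e)) + (- (Z *v (J_mat *v e))) \<bullet> (M *v - (Z *v (J_mat *v e)))"
      by (rule second_order[OF sym psd locX u(1)]) (simp_all add: Au[unfolded A_def] XJZv mv_minus_right)
    have JZ: "(Z *v e) \<bullet> (J_mat *v - (Z *v (J_mat *v e))) = e \<bullet> (R *v e)"
    proof -
      have "(Z *v e) \<bullet> (J_mat *v - (Z *v (J_mat *v e))) = - (e \<bullet> ((transpose Z ** J_mat ** Z) *v (J_mat *v e)))"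
        by (simp add: matrix_vector_mul_assoc[symmetric] inner_transpose_mv mv_minus_right)
      also have "\<dots> = e \<bullet> (R *v e)"
        unfolding ZJZ by (simp add: matrix_vector_mul_assoc[symmetric] J_J_mv mv_minus_right)
      finally show ?thesis .
    qed
    have Tx: "(Z *v x) \<bullet> (M *v (Z *v x)) = x \<bullet> (T *v x)" for x
      by (simp add: T_def matrix_vector_mul_assoc[symmetric] inner_transpose_mv)
    have "(J_mat *v e) \<bullet> (T *v (J_mat *v e)) = e \<bullet> (T *v e)"
    proof -
      have "T *v (J_mat *v e) = J_mat *v (T *v e)"
        by (simp add: matrix_vector_mul_assoc TJ)
      then show ?thesis
        by (simp add: inner_J_skew J_J_mv)
    qed
    then have "(- (Z *v (J_mat *v e))) \<bullet> (M *v - (Z *v (J_mat *v e))) = e \<bullet> (T *v e)"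
      by (simp add: mv_minus_right Tx)
    then show ?thesis
      using le unfolding JZ Tx by simp
  qed
  then have trT: "d * trace R \<le> trace T"
    unfolding trace_eq_sum_inner sum_distrib_left by (rule sum_mono)

  \<comment> \<open>At an eigenvector w for the least eigenvalue m of R, the nonnegative number w^T
    T w equals m (w^T B w), and B is positive definite, so m \<ge> 0.\<close>
  have R_psd: "0 \<le> v \<bullet> (R *v v)" for v
  proof -
    obtain w m where w: "norm w = 1" "R *v w = m *\<^sub>R w" and m: "\<And>v. m * (v \<bullet> v) \<le> v \<bullet> (R *v v)"
      by (rule exists_min_eigenvector[OF R_sym]) blast
    have "w \<bullet> (T *v w) = (R *v w) \<bullet> (B *v w)"
      using inner_transpose_mv[of w R "B *v w"] by (simp add: T R_sym matrix_vector_mul_assoc)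
    moreover have "w \<bullet> (T *v w) = (Z *v w) \<bullet> (M *v (Z *v w))"
      by (simp add: T_def matrix_vector_mul_assoc[symmetric] inner_transpose_mv)
    ultimately have "0 \<le> m * (w \<bullet> (B *v w))"
      using psd[of "Z *v w"] w by simp
    moreover have "0 < w \<bullet> (B *v w)"
      using B_pos[of w] w(1) by fastforce
    ultimately have "0 \<le> m"
      by (simp add: zero_le_mult_iff)
    then show ?thesis
      using m[of v] by (meson inner_ge_zero mult_nonneg_nonneg order_trans)
  qed
  have "norm (P *v v) \<le> norm v" for v
  proof -
    have "v \<bullet> (R *v v) = v \<bullet> v - (P *v v) \<bullet> (P *v v)"
      by (simp add: R_def matrix_vector_mult_diff_rdistrib inner_diff_right matrix_vector_mul_assoc[symmetric]
          inner_transpose_mv)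
    then show ?thesis
      using R_psd[of v] by (simp add: norm_le)
  qed
  then have Pt: "norm (transpose P *v v) \<le> norm v" for v
    by (rule contraction_transpose)

  \<comment> \<open>The counterpart of R on the side of A: it has the same trace as R and is
    positive semidefinite because P^T is a contraction too.\<close>
  define S where "S = mat 1 - P ** transpose P"
  have "v \<bullet> (S *v v) = v \<bullet> v - (transpose P *v v) \<bullet> (transpose P *v v)" for v
    using inner_transpose_mv[of v "transpose P" "transpose P *v v"]
    by (simp add: S_def matrix_vector_mult_diff_rdistrib inner_diff_right matrix_vector_mul_assoc[symmetric])
  then have "0 \<le> v \<bullet> (S *v v)" for v
    using Pt[of v] by (simp add: norm_le)
  moreover have "transpose S = S"
    by (simp add: S_def transpose_diff matrix_transpose_mul)
  moreover have "0 \<le> v \<bullet> ((d *\<^sub>R mat 1 - A) *v v)" for v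
    using A_le[of v] by (simp add: matrix_vector_mult_diff_rdistrib mv_scaleR_left inner_diff_right)
  ultimately have "0 \<le> trace (S ** (d *\<^sub>R mat 1 - A))"
    by (intro trace_mult_psd_nonneg)
  also have "\<dots> = d * trace S - trace A + trace (P ** (transpose P ** A))"
    by (simp add: mm_diff_right mm_scaleR_right trace_sub trace_scaleR)
      (simp add: S_def mm_diff_left trace_sub matrix_mul_assoc)
  \<comment> \<open>Cyclicity and A P = P B transfer the remaining term from A to B, where P^T P = 1
    - R turns it into tr B - tr T.\<close>
  also have "trace (P ** (transpose P ** A)) = trace (transpose P ** P ** B)"
    using trace_mul_sym[of P "transpose P ** A"] by (simp add: matrix_mul_assoc[symmetric] AP)
  also have "\<dots> = trace B - trace T"
    by (simp add: T R_def mm_diff_left trace_sub)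
  also have "trace S = trace R"
    by (simp add: S_def R_def trace_sub trace_mul_sym[of P])
  finally show ?thesis
    using trT by (simp add: A_def B_def)
qed

theorem proposition4p11:
  fixes M :: "real^('n::finite + 'n)^('n + 'n)"
    and X :: "real^('k::finite + 'k)^('n + 'n)"
  assumes "sym_pos_def M"
    and "CARD('k) \<le> CARD('n)"
    and "local_minimizer (\<lambda>Y. trace (transpose Y ** M ** Y)) symplectic_feasible X"
  shows "global_minimizer (\<lambda>Y. trace (transpose Y ** M ** Y)) symplectic_feasible X"
proof -
  have X: "X \<in> symplectic_feasible"
    using assms(3) by (rule local_minimizer_in)
  \<comment> \<open>X itself witnesses that the feasible set is nonempty.\<close>
  then obtain Y :: "real^('k + 'k)^('n + 'n)"
    where Y: "global_minimizer (\<lambda>Y. trace (transpose Y ** M ** Y)) symplectic_feasible Y"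
    using exists_global_minimizer[OF assms(1) closed_symplectic_feasible] by blast
  have "trace (transpose X ** M ** X) \<le> trace (transpose Y ** M ** Y)"
    using assms(1,3) global_imp_local_minimizer[OF Y] by (rule local_minimizer_le_global)
  then show ?thesis
    using X Y by (fastforce simp: global_minimizer_def)
qed

end
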